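(* Let $U\subset\mathbb{C}$ be a conjugate symmetric subset, and let $f:U\to\mathbb{C}$. The following conditions are equivalent: (1) $f\in\mathcal{S}(U)$, that is, $f(\bar\zeta)=\overline{f(\zeta)}$ for all $\zeta\in U$; (2) $f_\sigma(\kappa)$ belongs to $\mathbb{C}_{\mathfrak{s}}$ and $f_\sigma(\kappa^* )=f_\sigma(\kappa)^*$ for all $\kappa\in U_\sigma\cap\mathbb{C}_{\mathfrak{s}}$ and all $\mathfrak{s}\in\mathbb{S}_n$, where $\mathbb{C}_{\mathfrak{s}}=\{u+v\mathfrak{s}:u,v\in\mathbb{R}\}$.
   Context: $n\ge0$ is a fixed integer. $\mathfrak{C}_n$ is the unital associative real algebra generated by $e_0=1,e_1,\dots,e_n$ with $e_j^2=-1$, $e_je_k=-e_ke_j$ ($j,k=1,\dots,n$, $j\ne k$), with basis $e_J=e_{j_1}\cdots e_{j_p}$ for $J=\{j_1<\dots<j_p\}\subset\{1,\dots,n\}$, $e_\emptyset=1$. $\mathfrak{P}_n=\mathrm{span}_{\mathbb R}\{1,e_1,\dots,e_n\}$ is the space of paravectors. For $\kappa=a_0+\sum_{k=1}^n a_ke_k\in\mathfrak{P}_n$: $\Re(\kappa)=a_0$, $\Im(\kappa)=\sum_{k\ge1}a_ke_k$, $\kappa^*=\Re(\kappa)-\Im(\kappa)$, $|\kappa|^2=\sum_{k\ge0}a_k^2$. $\mathbb{S}_n=\{\sum_{k=1}^n s_ke_k:\sum s_k^2=1\}$. $\mathfrak{K}_n=\mathbb{C}\otimes_{\mathbb R}\mathfrak{C}_n=\mathfrak{C}_n+i\mathfrak{C}_n$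 (complex numbers are central). The spectrum of $\kappa\in\mathfrak{P}_n$ in $\mathfrak{K}_n$ is $\sigma(\kappa)=\{s_+(\kappa),s_-(\kappa)\}$, $s_\pm(\kappa)=\Re(\kappa)\pm i|\Im(\kappa)|$. A set $U\subset\mathbb{C}$ is conjugate symmetric if $\zeta\in U\iff\bar\zeta\in U$, and $U_\sigma=\{\kappa\in\mathfrak{P}_n:\sigma(\kappa)\subset U\}$. For $f:U\to\mathbb{C}$, the function $f_\sigma:U_\sigma\to\mathfrak{K}_n$ is defined by $f_\sigma(\kappa)=f(s_+(\kappa))\frac{1-i\mathfrak{s}}{2}+f(s_-(\kappa))\frac{1+i\mathfrak{s}}{2}$ with $\mathfrak{s}=\Im(\kappa)/|\Im(\kappa)|$ if $\kappa\in U_\sigma\setminus\mathbb{R}$, and $f_\sigma(r)=f(r)$ if $r\in U_\sigma\cap\mathbb{R}$.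
   Formalization: The formal statement assumes n ≥ 1 instead of n ≥ 0; for n = 0 the set S_n is empty, so condition (2) holds vacuously while (1) can fail (U = {0}, f(0) = i). *)

theory Defs
  imports Complex_Main
begin

section \<open>The complexified Clifford algebra\<close>

text \<open>
  The type \<open>'n kliff\<close> is the complexification of the real Clifford algebra with one generator
  \<open>e j\<close>, \<open>e j * e j = - 1\<close>, for every element of the finite linearly ordered index
  type \<open>'n\<close>; the number of generators is \<open>CARD('n) \<ge> 1\<close>. An element is given by its complex
  coordinates with respect to the basis of ordered products \<open>e j1 * \<dots> * e jp\<close>, one for each
  \<open>J = {j1 < \<dots> < jp}\<close>. The real Clifford algebra is the set of elements with real coordinates.
\<close>

typedef 'n kliff = "UNIV :: ('n set \<Rightarrow> complex) set"
  morphisms coef Kliff ..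

lemma coef_Kliff [simp]: "coef (Kliff f) = f"
  by (simp add: Kliff_inverse)

lemma kliff_eqI: "(\<And>J. coef a J = coef b J) \<Longrightarrow> a = b"
  by (metis coef_inject ext)

text \<open>
  Sorting the product of the ordered monomials indexed by \<open>J\<close> and \<open>K\<close> costs a factor \<open>- 1\<close> for
  each pair with \<open>k < j\<close> (anticommutation) and for each pair with \<open>k = j\<close> (square \<open>- 1\<close>).
\<close>

definition cliff_sign :: "'n::{finite,linorder} set \<Rightarrow> 'n set \<Rightarrow> real" where
  "cliff_sign J K = (\<Prod>j\<in>J. \<Prod>k\<in>K. if k \<le> j then - 1 else 1)"

lemma prod_sym_diff:
  fixes f :: "'n::finite \<Rightarrow> real"
  assumes "\<And>j. f j * f j = 1"
  shows "prod f (sym_diff J K) = prod f J * prod f K"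
proof -
  have J: "prod f J = prod f (J - K) * prod f (J \<inter> K)"
    by (subst prod.union_disjoint [symmetric]) (auto intro: arg_cong [where f = "prod f"])
  have K: "prod f K = prod f (K - J) * prod f (J \<inter> K)"
    by (subst prod.union_disjoint [symmetric]) (auto intro: arg_cong [where f = "prod f"])
  have I: "prod f (J \<inter> K) * prod f (J \<inter> K) = 1"
    by (simp add: prod.distrib [symmetric] assms)
  have "prod f (sym_diff J K) = prod f (J - K) * prod f (K - J)"
    by (rule prod.union_disjoint) auto
  also have "\<dots> = prod f (J - K) * prod f (K - J) * (prod f (J \<inter> K) * prod f (J \<inter> K))"
    by (simp only: I mult_1_right)
  also have "\<dots> = prod f J * prod f K"
    by (simp only: J K mult_ac)
  finally show ?thesis .
qed

lemma cliff_sign_left: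
  "cliff_sign (sym_diff J K) L = cliff_sign J L * cliff_sign K L"
  unfolding cliff_sign_def
  by (rule prod_sym_diff) (auto simp: prod.distrib [symmetric] intro!: prod.neutral)

lemma cliff_sign_right:
  "cliff_sign J (sym_diff K L) = cliff_sign J K * cliff_sign J L"
  unfolding cliff_sign_def prod.distrib [symmetric]
  by (rule prod.cong [OF refl], rule prod_sym_diff) auto

instantiation kliff :: ("{finite,linorder}") real_algebra_1
begin

definition zero_kliff :: "'a kliff" where
  "0 = Kliff (\<lambda>_. 0)"

definition one_kliff :: "'a kliff" where
  "1 = Kliff (\<lambda>J. if J = {} then 1 else 0)"

definition plus_kliff :: "'a kliff \<Rightarrow> 'a kliff \<Rightarrow> 'a kliff" where
  "a + b = Kliff (\<lambda>J. coef a J + coef b J)"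

definition uminus_kliff :: "'a kliff \<Rightarrow> 'a kliff" where
  "- a = Kliff (\<lambda>J. - coef a J)"

definition minus_kliff :: "'a kliff \<Rightarrow> 'a kliff \<Rightarrow> 'a kliff" where
  "a - b = Kliff (\<lambda>J. coef a J - coef b J)"

definition scaleR_kliff :: "real \<Rightarrow> 'a kliff \<Rightarrow> 'a kliff" where
  "r *\<^sub>R a = Kliff (\<lambda>J. of_real r * coef a J)"

text \<open>The products contributing to the coordinate \<open>L\<close> are those of \<open>J\<close> and \<open>sym_diff J L\<close>.\<close>

definition times_kliff :: "'a kliff \<Rightarrow> 'a kliff \<Rightarrow> 'a kliff" where
  "a * b = Kliff (\<lambda>L. \<Sum>J\<in>UNIV.
     of_real (cliff_sign J (sym_diff J L)) * coef a J * coef b (sym_diff J L))"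

lemma coef_simps [simp]:
  "coef (0 :: 'a kliff) J = 0"
  "coef (1 :: 'a kliff) J = (if J = {} then 1 else 0)"
  "coef (a + b :: 'a kliff) J = coef a J + coef b J"
  "coef (- a :: 'a kliff) J = - coef a J"
  "coef (a - b :: 'a kliff) J = coef a J - coef b J"
  "coef (r *\<^sub>R a :: 'a kliff) J = of_real r * coef a J"
  by (simp_all add: zero_kliff_def one_kliff_def plus_kliff_def uminus_kliff_def
      minus_kliff_def scaleR_kliff_def)

lemma coef_mult:
  "coef (a * b :: 'a kliff) L = (\<Sum>J\<in>UNIV.
     of_real (cliff_sign J (sym_diff J L)) * coef a J * coef b (sym_diff J L))"
  by (simp add: times_kliff_def)

instance
proof
  fix a b c :: "'a kliff" and r s :: real
  show "a * b * c = a * (b * c)"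
  proof (rule kliff_eqI)
    fix M :: "'a set"
    have *: "(\<Sum>L\<in>UNIV. of_real (cliff_sign J (sym_diff J L) * cliff_sign L (sym_diff L M))
                * coef a J * coef b (sym_diff J L) * coef c (sym_diff L M))
        = (\<Sum>K\<in>UNIV. of_real (cliff_sign J (sym_diff J M) * cliff_sign K (sym_diff K (sym_diff J M)))
                * coef a J * coef b K * coef c (sym_diff K (sym_diff J M)))" for J :: "'a set"
    proof (rule sum.reindex_bij_witness [of _ "sym_diff J" "sym_diff J"])
      fix L :: "'a set"
      have 1: "sym_diff (sym_diff J L) (sym_diff J M) = sym_diff L M"
        by auto
      have 2: "sym_diff J M = sym_diff (sym_diff J L) (sym_diff L M)"
        by auto
      have 3: "cliff_sign L (sym_diff L M)
          = cliff_sign J (sym_diff L M) * cliff_sign (sym_diff J L) (sym_diff L M)"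
      proof -
        have "L = sym_diff J (sym_diff J L)"
          by auto
        then show ?thesis
          using cliff_sign_left [of J "sym_diff J L" "sym_diff L M"] by simp
      qed
      have 4: "cliff_sign J (sym_diff J M)
          = cliff_sign J (sym_diff J L) * cliff_sign J (sym_diff L M)"
        by (subst 2) (rule cliff_sign_right)
      show "of_real (cliff_sign J (sym_diff J M) *
              cliff_sign (sym_diff J L) (sym_diff (sym_diff J L) (sym_diff J M)))
            * coef a J * coef b (sym_diff J L) * coef c (sym_diff (sym_diff J L) (sym_diff J M))
          = of_real (cliff_sign J (sym_diff J L) * cliff_sign L (sym_diff L M))
            * coef a J * coef b (sym_diff J L) * coef c (sym_diff L M)"
        by (simp only: 1 3 4 mult_ac)
    qed auto
    have "coef (a * b * c) M = (\<Sum>L\<in>UNIV. \<Sum>J\<in>UNIV.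
        of_real (cliff_sign J (sym_diff J L) * cliff_sign L (sym_diff L M))
                * coef a J * coef b (sym_diff J L) * coef c (sym_diff L M))"
      by (simp add: coef_mult sum_distrib_left sum_distrib_right mult_ac)
    also have "\<dots> = (\<Sum>J\<in>UNIV. \<Sum>L\<in>UNIV.
        of_real (cliff_sign J (sym_diff J L) * cliff_sign L (sym_diff L M))
                * coef a J * coef b (sym_diff J L) * coef c (sym_diff L M))"
      by (rule sum.swap)
    also have "\<dots> = (\<Sum>J\<in>UNIV. \<Sum>K\<in>UNIV.
        of_real (cliff_sign J (sym_diff J M) * cliff_sign K (sym_diff K (sym_diff J M)))
                * coef a J * coef b K * coef c (sym_diff K (sym_diff J M)))"
      by (simp only: *)
    also have "\<dots> = coef (a * (b * c)) M"
      by (simp add: coef_mult sum_distrib_left sum_distrib_right mult_ac)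
    finally show "coef (a * b * c) M = coef (a * (b * c)) M" .
  qed
  show "1 * a = a"
  proof (rule kliff_eqI)
    fix L
    have "coef (1 * a) L
        = (\<Sum>J\<in>(UNIV :: 'a set set). if J = {} then of_real (cliff_sign {} L) * coef a L else 0)"
      unfolding coef_mult by (rule sum.cong) auto
    then show "coef (1 * a) L = coef a L"
      by (simp add: cliff_sign_def)
  qed
  show "a * 1 = a"
  proof (rule kliff_eqI)
    fix L
    have "coef (a * 1) L
        = (\<Sum>J\<in>UNIV. if J = L then of_real (cliff_sign L {}) * coef a L else 0)"
      unfolding coef_mult by (rule sum.cong) auto
    then show "coef (a * 1) L = coef a L"
      by (simp add: cliff_sign_def)
  qed
  show "(a + b) * c = a * c + b * c" "a * (b + c) = a * b + a * c"
    by (rule kliff_eqI, simp add: coef_mult algebra_simps sum.distrib)+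
  show "r *\<^sub>R a * b = r *\<^sub>R (a * b)" "a * r *\<^sub>R b = r *\<^sub>R (a * b)"
    by (rule kliff_eqI, simp add: coef_mult sum_distrib_left mult_ac)+
  show "(0 :: 'a kliff) \<noteq> 1"
    by (metis coef_simps(1,2) zero_neq_one)
qed (rule kliff_eqI, simp add: algebra_simps)+

end

definition basis :: "'n set \<Rightarrow> 'n kliff" where
  "basis J = Kliff (\<lambda>K. if K = J then 1 else 0)"

abbreviation e :: "'n \<Rightarrow> 'n kliff" where
  "e j \<equiv> basis {j}"

lemma coef_basis [simp]: "coef (basis J) K = (if K = J then 1 else 0)"
  by (simp add: basis_def)

lemma basis_mult:
  fixes J K :: "'n::{finite,linorder} set"
  shows "basis J * basis K = cliff_sign J K *\<^sub>R basis (sym_diff J K)"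
proof (rule kliff_eqI)
  fix L
  have "sym_diff J L = K \<longleftrightarrow> L = sym_diff J K"
    by auto
  then have "coef (basis J * basis K) L
      = (\<Sum>I\<in>UNIV. if I = J then of_real (cliff_sign J K) * (if L = sym_diff J K then 1 else 0) else 0)"
    unfolding coef_mult by (intro sum.cong) auto
  then show "coef (basis J * basis K) L = coef (cliff_sign J K *\<^sub>R basis (sym_diff J K)) L"
    by simp
qed

lemma basis_empty: "basis {} = (1 :: 'n::{finite,linorder} kliff)"
  by (rule kliff_eqI) simp

lemma e_square: "e j * e j = (- 1 :: 'n::{finite,linorder} kliff)"
  by (simp add: basis_mult cliff_sign_def basis_empty)

lemma e_anticommute:
  fixes j k :: "'n::{finite,linorder}"
  assumes "j \<noteq> k"
  shows "e j * e k = - (e k * e j)"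
  using assms by (auto simp: basis_mult cliff_sign_def insert_commute)

lemma basis_eq_ordered_product:
  fixes J :: "'n::{finite,linorder} set"
  shows "basis J = prod_list (map e (sorted_list_of_set J))"
proof -
  have "sorted_wrt (<) xs \<Longrightarrow> prod_list (map e xs) = basis (set xs)" for xs :: "'n list"
  proof (induction xs)
    case Nil
    then show ?case by (simp add: basis_empty)
  next
    case (Cons x xs)
    have "cliff_sign {x} (set xs) = 1"
      using Cons.prems by (auto simp: cliff_sign_def not_le intro!: prod.neutral)
    moreover have "sym_diff {x} (set xs) = insert x (set xs)"
      using Cons.prems by auto
    ultimately show ?case
      using Cons by (simp add: basis_mult)
  qed
  from this [of "sorted_list_of_set J"] show ?thesis
    by simp
qed

definition cscale :: "complex \<Rightarrow> 'n kliff \<Rightarrow> 'n kliff" where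
  "cscale z a = Kliff (\<lambda>J. z * coef a J)"

abbreviation cplx :: "complex \<Rightarrow> 'n::{finite,linorder} kliff" where
  "cplx z \<equiv> cscale z 1"

lemma coef_cscale [simp]: "coef (cscale z a) J = z * coef a J"
  by (simp add: cscale_def)

lemma cscale_of_real: "cscale (of_real r) a = r *\<^sub>R a"
  by (rule kliff_eqI) simp

lemma cscale_mult_left: "cscale z a * b = cscale z (a * b)"
  by (rule kliff_eqI) (simp add: coef_mult sum_distrib_left mult_ac)

lemma cscale_mult_right: "a * cscale z b = cscale z (a * b)"
  by (rule kliff_eqI) (simp add: coef_mult sum_distrib_left mult_ac)

lemma basis_expansion:
  fixes a :: "'n::{finite,linorder} kliff"
  shows "a = (\<Sum>J\<in>UNIV. cscale (coef a J) (basis J))"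
proof (rule kliff_eqI)
  fix K
  have "coef (\<Sum>J\<in>S. f J) K = (\<Sum>J\<in>S. coef (f J) K)" if "finite S"
    for S :: "'n set set" and f :: "'n set \<Rightarrow> 'n kliff"
    using that by induction auto
  then show "coef a K = coef (\<Sum>J\<in>UNIV. cscale (coef a J) (basis J)) K"
    by (simp add: if_distrib cong: if_cong)
qed


section \<open>Paravectors\<close>

definition paravectors :: "'n::{finite,linorder} kliff set" where
  "paravectors = span (insert 1 (range e))"

text \<open>
  The following operations are meant for paravectors only, where the coordinates are real.
\<close>

definition pRe :: "'n::{finite,linorder} kliff \<Rightarrow> real" where
  "pRe \<kappa> = Re (coef \<kappa> {})"

definition pIm :: "'n::{finite,linorder} kliff \<Rightarrow> 'n kliff" where
  "pIm \<kappa> = (\<Sum>k\<in>UNIV. Re (coef \<kappa> {k}) *\<^sub>R e k)"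

definition pstar :: "'n::{finite,linorder} kliff \<Rightarrow> 'n kliff" where
  "pstar \<kappa> = of_real (pRe \<kappa>) - pIm \<kappa>"

definition pnorm :: "'n::{finite,linorder} kliff \<Rightarrow> real" where
  "pnorm \<kappa> = sqrt ((pRe \<kappa>)\<^sup>2 + (\<Sum>k\<in>UNIV. (Re (coef \<kappa> {k}))\<^sup>2))"

definition unit_vectors :: "'n::{finite,linorder} kliff set" where
  "unit_vectors = {\<Sum>k\<in>UNIV. s k *\<^sub>R e k | s. (\<Sum>k\<in>UNIV. (s k)\<^sup>2) = (1 :: real)}"

definition slice :: "'n::{finite,linorder} kliff \<Rightarrow> 'n kliff set" where
  "slice \<ss> = {of_real u + v *\<^sub>R \<ss> | u v. True}"


section \<open>Spectrum\<close>

definition kliff_invertible :: "'n::{finite,linorder} kliff \<Rightarrow> bool" where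
  "kliff_invertible a \<longleftrightarrow> (\<exists>b. a * b = 1 \<and> b * a = 1)"

definition spectrum :: "'n::{finite,linorder} kliff \<Rightarrow> complex set" where
  "spectrum \<kappa> = {\<zeta>. \<not> kliff_invertible (cplx \<zeta> - \<kappa>)}"

definition s_plus :: "'n::{finite,linorder} kliff \<Rightarrow> complex" where
  "s_plus \<kappa> = Complex (pRe \<kappa>) (pnorm (pIm \<kappa>))"

definition s_minus :: "'n::{finite,linorder} kliff \<Rightarrow> complex" where
  "s_minus \<kappa> = Complex (pRe \<kappa>) (- pnorm (pIm \<kappa>))"

lemma coef_sum: "coef (\<Sum>i\<in>S. f i) J = (\<Sum>i\<in>S. coef (f i) J)"
  for f :: "'i \<Rightarrow> 'n::{finite,linorder} kliff"
  by (induction S rule: infinite_finite_induct) auto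

lemma paravector_decomp:
  assumes "\<kappa> \<in> paravectors"
  shows "\<kappa> = of_real (pRe \<kappa>) + pIm \<kappa>"
  using assms unfolding paravectors_def
proof (induction rule: span_induct_alt)
  case base
  show ?case by (simp add: pRe_def pIm_def)
next
  case (step c x y)
  have lin: "of_real (pRe (c *\<^sub>R x + y)) + pIm (c *\<^sub>R x + y)
      = c *\<^sub>R (of_real (pRe x) + pIm x) + (of_real (pRe y) + pIm y)"
    by (simp add: pRe_def pIm_def scaleR_add_left sum.distrib scaleR_sum_right
        of_real_def algebra_simps)
  have "of_real (pRe x) + pIm x = x"
  proof (cases "x = 1")
    case True
    then show ?thesis by (simp add: pRe_def pIm_def)
  next
    case False
    with step obtain j where "x = e j" by auto
    then show ?thesis
      by (simp add: pRe_def pIm_def if_distrib [of Re] if_distrib [of "\<lambda>r. r *\<^sub>R _"]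
          cong: if_cong)
  qed
  with lin step show ?case by simp
qed

lemma vector_square:
  fixes s :: "'n::{finite,linorder} \<Rightarrow> real"
  shows "(\<Sum>k\<in>UNIV. s k *\<^sub>R e k) * (\<Sum>k\<in>UNIV. s k *\<^sub>R e k) = of_real (- (\<Sum>k\<in>UNIV. (s k)\<^sup>2))"
proof -
  define v where "v = (\<Sum>k\<in>UNIV. s k *\<^sub>R e k)"
  have A: "v * v = (\<Sum>j\<in>UNIV. \<Sum>k\<in>UNIV. (s j * s k) *\<^sub>R (e j * e k))"
    by (simp add: v_def sum_product mult.commute)
  then have B: "v * v = (\<Sum>j\<in>UNIV. \<Sum>k\<in>UNIV. (s j * s k) *\<^sub>R (e k * e j))"
    by (subst (asm) sum.swap) (simp add: mult.commute)
  have C: "e j * e k + e k * e j = (if j = k then - 2 else 0)" for j k :: 'n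
    using e_anticommute [of j k] by (auto simp: e_square)
  have "v * v + v * v = (\<Sum>j\<in>UNIV. \<Sum>k\<in>UNIV. (s j * s k) *\<^sub>R (e j * e k + e k * e j))"
    by (subst (1) A, subst B) (simp add: sum.distrib scaleR_add_right)
  also have "\<dots> = (\<Sum>j\<in>UNIV. (s j * s j) *\<^sub>R (- 2))"
    by (simp add: C if_distrib [of "scaleR _"] cong: if_cong)
  also have "\<dots> = of_real (- (\<Sum>k\<in>UNIV. (s k)\<^sup>2)) + of_real (- (\<Sum>k\<in>UNIV. (s k)\<^sup>2))"
    by (simp add: scaleR_conv_of_real power2_eq_square sum_negf sum_subtractf mult_2_right)
  finally have "2 *\<^sub>R (v * v) = 2 *\<^sub>R of_real (- (\<Sum>k\<in>UNIV. (s k)\<^sup>2))"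
    by (simp only: scaleR_2)
  then show ?thesis
    unfolding v_def by (simp only: scaleR_cancel_left) simp
qed

lemma pnorm_pIm: "(pnorm (pIm \<kappa>))\<^sup>2 = (\<Sum>k\<in>UNIV. (Re (coef \<kappa> {k}))\<^sup>2)"
proof -
  have "pRe (pIm \<kappa>) = 0"
    by (simp add: pRe_def pIm_def coef_sum)
  moreover have "Re (coef (pIm \<kappa>) {k}) = Re (coef \<kappa> {k})" for k
    by (simp add: pIm_def coef_sum if_distrib [of "(*) _"] cong: if_cong)
  ultimately show ?thesis
    by (simp add: pnorm_def sum_nonneg)
qed

lemma pIm_square: "pIm \<kappa> * pIm \<kappa> = of_real (- ((pnorm (pIm \<kappa>))\<^sup>2))"
  unfolding pnorm_pIm by (simp only: pIm_def vector_square)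

lemma spectrum_paravector:
  fixes \<kappa> :: "'n::{finite,linorder} kliff"
  assumes "\<kappa> \<in> paravectors"
  shows "spectrum \<kappa> = {s_plus \<kappa>, s_minus \<kappa>}"
proof (rule set_eqI)
  fix \<zeta> :: complex
  define w where "w = \<zeta> - of_real (pRe \<kappa>)"
  define t where "t = pnorm (pIm \<kappa>)"
  define v where "v = pIm \<kappa>"
  define d where "d = w\<^sup>2 + of_real (t\<^sup>2)"
  have cplx_real: "of_real r = cplx (of_real r)" for r
    unfolding cscale_of_real by (simp add: of_real_def)
  have diff: "cplx (x - y) = cplx x - cplx y" for x y
    by (rule kliff_eqI) auto
  have eq: "cplx \<zeta> - \<kappa> = cplx w - v"
    by (subst paravector_decomp [OF assms]) (simp add: w_def v_def diff cplx_real)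
  have vv: "v * v = cplx (- of_real (t\<^sup>2))"
    unfolding v_def pIm_square t_def cplx_real by simp
  have ww: "cplx w * cplx w = cplx (w\<^sup>2)"
    by (rule kliff_eqI) (auto simp: cscale_mult_left power2_eq_square)
  have comm: "v * cplx w = cplx w * v"
    by (simp add: cscale_mult_left cscale_mult_right)
  have dd: "cplx (w\<^sup>2) - cplx (- of_real (t\<^sup>2)) = cplx d"
    by (simp add: d_def flip: diff)
  have prod1: "(cplx w - v) * (cplx w + v) = cplx d"
    unfolding dd [symmetric] by (simp only: left_diff_distrib distrib_left vv ww comm) simp
  have prod2: "(cplx w + v) * (cplx w - v) = cplx d"
    unfolding dd [symmetric] by (simp only: distrib_right right_diff_distrib vv ww comm) simp
  have "d = (\<zeta> - s_plus \<kappa>) * (\<zeta> - s_minus \<kappa>)"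
    by (simp add: d_def w_def t_def s_plus_def s_minus_def complex_eq_iff power2_eq_square
        algebra_simps)
  then have root: "\<zeta> \<in> {s_plus \<kappa>, s_minus \<kappa>} \<longleftrightarrow> d = 0"
    by auto
  have "kliff_invertible (cplx w - v) \<longleftrightarrow> d \<noteq> 0"
  proof
    assume "d \<noteq> 0"
    have "cscale (1 / d) (cplx d) = 1"
      using \<open>d \<noteq> 0\<close> by (intro kliff_eqI) simp
    then show "kliff_invertible (cplx w - v)"
      unfolding kliff_invertible_def
      by (intro exI [of _ "cscale (1 / d) (cplx w + v)"])
        (simp only: cscale_mult_left cscale_mult_right prod1 prod2)
  next
    assume "kliff_invertible (cplx w - v)"
    then obtain b where b: "b * (cplx w - v) = 1" "(cplx w - v) * b = 1"
      unfolding kliff_invertible_def by blast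
    show "d \<noteq> 0"
    proof
      assume "d = 0"
      then have "(cplx w - v) * (cplx w + v) = 0"
        using prod1 by (simp add: kliff_eqI)
      then have "cplx w + v = 0"
        using b by (metis mult.assoc mult_1_left mult_zero_right)
      then have "coef (cplx w + v) {} = 0"
        by simp
      then have "w = 0"
        by (simp add: v_def pIm_def coef_sum)
      then have "v = 0"
        using \<open>cplx w + v = 0\<close> by (metis \<open>w = 0\<close> add.left_neutral coef_cscale coef_simps(1)
            kliff_eqI mult_zero_left)
      have "cplx w = (0 :: 'n kliff)"
        using \<open>w = 0\<close> by (intro kliff_eqI) simp
      with \<open>v = 0\<close> b show False by simp
    qed
  qed
  then show "\<zeta> \<in> spectrum \<kappa> \<longleftrightarrow> \<zeta> \<in> {s_plus \<kappa>, s_minus \<kappa>}"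
    by (simp only: spectrum_def mem_Collect_eq eq root not_not)
qed


section \<open>Functions of paravectors\<close>

definition conj_symmetric :: "complex set \<Rightarrow> bool" where
  "conj_symmetric U \<longleftrightarrow> (\<forall>\<zeta>. \<zeta> \<in> U \<longleftrightarrow> cnj \<zeta> \<in> U)"

definition U_sigma :: "complex set \<Rightarrow> 'n::{finite,linorder} kliff set" where
  "U_sigma U = {\<kappa> \<in> paravectors. spectrum \<kappa> \<subseteq> U}"

text \<open>
  A function on \<open>U\<close> is a total function of which only the values on \<open>U\<close> matter: for
  \<open>\<kappa> \<in> U_sigma U\<close> both \<open>s_plus \<kappa>\<close> and \<open>s_minus \<kappa>\<close> lie in \<open>U\<close>.
\<close>

definition f_sigma :: "(complex \<Rightarrow> complex) \<Rightarrow> 'n::{finite,linorder} kliff \<Rightarrow> 'n kliff" where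
  "f_sigma f \<kappa> =
     (if \<kappa> \<in> \<real> then cplx (f (of_real (pRe \<kappa>)))
      else let \<ss> = (1 / pnorm (pIm \<kappa>)) *\<^sub>R pIm \<kappa> in
        cscale (f (s_plus \<kappa>)) ((1 / 2) *\<^sub>R (1 - cscale \<i> \<ss>)) +
        cscale (f (s_minus \<kappa>)) ((1 / 2) *\<^sub>R (1 + cscale \<i> \<ss>)))"

definition stem_functions :: "complex set \<Rightarrow> (complex \<Rightarrow> complex) set" where
  "stem_functions U = {f. \<forall>\<zeta>\<in>U. f (cnj \<zeta>) = cnj (f \<zeta>)}"

end

theory Submission
  imports Defs
begin

text \<open>
  On a slice, the functional calculus has the closed form
  \<open>f_sigma f (u + v \<ss>) = (f \<zeta> + f (cnj \<zeta>)) / 2 + (\<i> (f (cnj \<zeta>) - f \<zeta>) / 2) \<ss>\<close> with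
  \<open>\<zeta> = u + \<i> v\<close>: changing the sign of \<open>v\<close> swaps \<open>s_plus\<close> with \<open>s_minus\<close> and negates the
  normalized imaginary part, so no case distinction on \<open>v\<close> remains. Such a value lies in the slice
  iff both coefficients are real, that is, iff \<open>f (cnj \<zeta>) = cnj (f \<zeta>)\<close>.
\<close>

lemma coef_of_real:
  "coef (of_real r :: 'n::{finite,linorder} kliff) J = (if J = {} then of_real r else 0)"
  by (subst of_real_def) simp

lemma coef_vector:
  fixes s :: "'n::{finite,linorder} \<Rightarrow> real"
  shows "coef (\<Sum>k\<in>UNIV. s k *\<^sub>R e k) {} = 0"
    and "coef (\<Sum>k\<in>UNIV. s k *\<^sub>R e k) {j} = of_real (s j)"
  by (simp_all add: coef_sum if_distrib [of "(*) _"] cong: if_cong)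

text \<open>The index type is nonempty, so there is at least one generator and the quantifier over
  unit vectors is not vacuous; the converse direction draws its slice from here.\<close>

lemma e_in_unit_vectors: "e j \<in> unit_vectors"
proof -
  have "(\<Sum>k\<in>UNIV. (if k = j then 1 else 0 :: real)\<^sup>2) = (\<Sum>k\<in>UNIV. if k = j then 1 else 0)"
    by (intro sum.cong) auto
  moreover have "e j = (\<Sum>k\<in>UNIV. (if k = j then 1 else 0) *\<^sub>R e k)"
    by (simp add: if_distrib [of "\<lambda>r. r *\<^sub>R _"] cong: if_cong)
  ultimately show ?thesis
    unfolding unit_vectors_def
    by (intro CollectI exI [of _ "\<lambda>k. if k = j then 1 else 0"]) simp
qed

lemma coef_unit_vector_empty: "\<ss> \<in> unit_vectors \<Longrightarrow> coef \<ss> {} = 0"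
  by (auto simp: unit_vectors_def coef_vector)

text \<open>Comparing coordinates at such a \<open>{k}\<close> turns an equation between multiples
  of \<open>\<ss>\<close> into one between scalars, and dividing by this coordinate preserves
  reality.\<close>

lemma unit_vector_coef_nonzero:
  assumes "\<ss> \<in> unit_vectors"
  obtains k where "Re (coef \<ss> {k}) \<noteq> 0" "Im (coef \<ss> {k}) = 0"
proof -
  from assms obtain s where s: "\<ss> = (\<Sum>k\<in>UNIV. s k *\<^sub>R e k)" "(\<Sum>k\<in>UNIV. (s k)\<^sup>2) = (1 :: real)"
    by (auto simp: unit_vectors_def)
  have "\<exists>k. s k \<noteq> 0"
  proof (rule ccontr)
    assume "\<nexists>k. s k \<noteq> 0"
    with s(2) show False by simp
  qed
  then obtain k where "s k \<noteq> 0" ..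
  then show thesis
    using that [of k] by (simp add: s(1) coef_vector)
qed

lemma pRe_slice:
  assumes "\<ss> \<in> unit_vectors"
  shows "pRe (of_real u + v *\<^sub>R \<ss>) = u"
  using coef_unit_vector_empty [OF assms] by (simp add: pRe_def coef_of_real)

lemma pIm_slice:
  assumes "\<ss> \<in> unit_vectors"
  shows "pIm (of_real u + v *\<^sub>R \<ss>) = v *\<^sub>R \<ss>"
proof -
  from assms obtain s where s: "\<ss> = (\<Sum>k\<in>UNIV. s k *\<^sub>R e k)"
    by (auto simp: unit_vectors_def)
  have "Re (coef \<ss> {k}) = s k" for k
    by (simp only: s coef_vector Re_complex_of_real)
  then show ?thesis
    by (simp add: pIm_def coef_of_real) (simp add: s scaleR_sum_right)
qed

lemma pstar_slice:
  assumes "\<ss> \<in> unit_vectors"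
  shows "pstar (of_real u + v *\<^sub>R \<ss>) = of_real u + (- v) *\<^sub>R \<ss>"
  unfolding pstar_def pRe_slice [OF assms] pIm_slice [OF assms] by simp

lemma pnorm_slice:
  assumes "\<ss> \<in> unit_vectors"
  shows "pnorm (v *\<^sub>R \<ss>) = \<bar>v\<bar>"
proof -
  from assms obtain s where s: "\<ss> = (\<Sum>k\<in>UNIV. s k *\<^sub>R e k)" "(\<Sum>k\<in>UNIV. (s k)\<^sup>2) = (1 :: real)"
    by (auto simp: unit_vectors_def)
  have "Re (coef \<ss> {k}) = s k" for k
    by (simp only: s coef_vector Re_complex_of_real)
  moreover have "pRe (v *\<^sub>R \<ss>) = 0"
    using pRe_slice [OF assms, of 0 v] by simp
  ultimately show ?thesis
    by (simp add: pnorm_def power_mult_distrib s(2) flip: sum_distrib_left)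
qed

lemma s_plus_s_minus_slice:
  assumes "\<ss> \<in> unit_vectors"
  shows "s_plus (of_real u + v *\<^sub>R \<ss>) = Complex u \<bar>v\<bar>"
    and "s_minus (of_real u + v *\<^sub>R \<ss>) = Complex u (- \<bar>v\<bar>)"
  using assms by (simp_all add: s_plus_def s_minus_def pRe_slice pIm_slice pnorm_slice)

lemma slice_in_paravectors:
  assumes "\<ss> \<in> unit_vectors"
  shows "of_real u + v *\<^sub>R \<ss> \<in> paravectors"
proof -
  from assms obtain s where "\<ss> = (\<Sum>k\<in>UNIV. s k *\<^sub>R e k)"
    by (auto simp: unit_vectors_def)
  moreover have "1 \<in> span (insert 1 (range e))" "e k \<in> span (insert 1 (range e))" for k :: 'a
    by (auto intro: span_base)
  ultimately show ?thesis
    unfolding paravectors_def of_real_def by (simp only:) (intro span_add span_scale span_sum)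
qed

text \<open>Whatever the sign of \<open>v\<close>, the spectrum consists of
  \<open>Complex u v\<close> and its conjugate, and a conjugate symmetric \<open>U\<close> contains
  both or neither.\<close>

lemma slice_in_U_sigma_iff:
  assumes "\<ss> \<in> unit_vectors" "conj_symmetric U"
  shows "of_real u + v *\<^sub>R \<ss> \<in> U_sigma U \<longleftrightarrow> Complex u v \<in> U"
proof -
  have "cnj (Complex u v) = Complex u (- v)"
    by (simp add: complex_eq_iff)
  then have "Complex u (- v) \<in> U \<longleftrightarrow> Complex u v \<in> U"
    using assms(2) unfolding conj_symmetric_def by metis
  then show ?thesis
    using slice_in_paravectors [OF assms(1)]
    by (auto simp: U_sigma_def spectrum_paravector s_plus_s_minus_slice [OF assms(1)] abs_if)
qed

text \<open>Decides which branch of \<open>f_sigma\<close> applies at a point of a slice.\<close>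

lemma slice_in_Reals_iff:
  assumes "\<ss> \<in> unit_vectors"
  shows "of_real u + v *\<^sub>R \<ss> \<in> \<real> \<longleftrightarrow> v = 0"
proof
  assume "of_real u + v *\<^sub>R \<ss> \<in> \<real>"
  then obtain r where r: "of_real u + v *\<^sub>R \<ss> = of_real r"
    by (auto elim: Reals_cases)
  obtain k where k: "Re (coef \<ss> {k}) \<noteq> 0"
    using unit_vector_coef_nonzero [OF assms] by blast
  have "coef (of_real u + v *\<^sub>R \<ss>) {k} = coef (of_real r :: 'a kliff) {k}"
    by (simp only: r)
  then show "v = 0"
    using k by (auto simp: coef_of_real complex_eq_iff)
qed simp

lemma f_sigma_slice:
  assumes "\<ss> \<in> unit_vectors"
  shows "f_sigma f (of_real u + v *\<^sub>R \<ss>) =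
    cplx ((f (Complex u v) + f (Complex u (- v))) / 2) +
    cscale (\<i> * (f (Complex u (- v)) - f (Complex u v)) / 2) \<ss>"
proof (cases "v = 0")
  case True
  \<comment> \<open>On the real axis both arguments of \<open>f\<close> equal \<open>u\<close>: the
    mean is the value in the real branch of \<open>f_sigma\<close>, and the coefficient of
    \<open>\<ss>\<close> vanishes.\<close>
  moreover have "of_real u = Complex u 0"
    by (simp add: complex_eq_iff)
  ultimately show ?thesis
    by (intro kliff_eqI) (simp add: f_sigma_def pRe_def coef_of_real)
next
  case False
  \<comment> \<open>\<open>f_sigma\<close> normalizes the imaginary part itself, which recovers the
    given \<open>\<ss>\<close> only up to the sign of \<open>v\<close>.\<close>
  have "(1 / \<bar>v\<bar>) *\<^sub>R v *\<^sub>R \<ss> = sgn v *\<^sub>R \<ss>"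
    by (simp add: sgn_div_norm divide_inverse mult.commute)
  then have "f_sigma f (of_real u + v *\<^sub>R \<ss>) =
      cscale (f (Complex u \<bar>v\<bar>)) ((1 / 2) *\<^sub>R (1 - cscale \<i> (sgn v *\<^sub>R \<ss>))) +
      cscale (f (Complex u (- \<bar>v\<bar>))) ((1 / 2) *\<^sub>R (1 + cscale \<i> (sgn v *\<^sub>R \<ss>)))"
    using False
    by (simp only: f_sigma_def slice_in_Reals_iff [OF assms] pIm_slice [OF assms]
        pnorm_slice [OF assms] s_plus_s_minus_slice [OF assms] Let_def if_False)
  then show ?thesis
    using False
    by (intro kliff_eqI) (cases "v > 0"; simp add: field_simps)
qed

text \<open>\<open>1\<close> and \<open>\<ss>\<close> are linearly independent over the complex
  numbers: \<open>\<ss>\<close> has no scalar coordinate, so \<open>a\<close> is read off at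
  \<open>{}\<close>, and \<open>b\<close> at some \<open>{k}\<close> where \<open>\<ss>\<close> has
  a nonzero real coordinate.\<close>

lemma cplx_combination_in_slice_iff:
  assumes "\<ss> \<in> unit_vectors"
  shows "cplx a + cscale b \<ss> \<in> slice \<ss> \<longleftrightarrow> a \<in> \<real> \<and> b \<in> \<real>"
proof
  assume "cplx a + cscale b \<ss> \<in> slice \<ss>"
  then obtain u v where eq: "cplx a + cscale b \<ss> = of_real u + v *\<^sub>R \<ss>"
    by (auto simp: slice_def)
  obtain k where k: "Re (coef \<ss> {k}) \<noteq> 0" "Im (coef \<ss> {k}) = 0"
    using unit_vector_coef_nonzero [OF assms] by blast
  have "coef (cplx a + cscale b \<ss>) {} = coef (of_real u + v *\<^sub>R \<ss>) {}"
    "coef (cplx a + cscale b \<ss>) {k} = coef (of_real u + v *\<^sub>R \<ss>) {k}"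
    by (simp_all only: eq)
  then show "a \<in> \<real> \<and> b \<in> \<real>"
    using k coef_unit_vector_empty [OF assms]
    by (auto simp: coef_of_real complex_eq_iff complex_is_Real_iff)
next
  assume "a \<in> \<real> \<and> b \<in> \<real>"
  then obtain u v where "a = of_real u" "b = of_real v"
    by (auto elim!: Reals_cases)
  then have "cplx a + cscale b \<ss> = of_real u + v *\<^sub>R \<ss>"
    by (intro kliff_eqI) (simp add: coef_of_real)
  then show "cplx a + cscale b \<ss> \<in> slice \<ss>"
    by (auto simp: slice_def)
qed

text \<open>Write \<open>z\<close> and \<open>w\<close> for the values of \<open>f\<close> at
  \<open>Complex u v\<close> and at its conjugate. Then \<open>z + w\<close> is real iff the
  imaginary parts are opposite, and \<open>\<i> * (w - z)\<close> is real iff the real parts agree;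
  together this is \<open>w = cnj z\<close>.\<close>

lemma f_sigma_in_slice_iff:
  assumes "\<ss> \<in> unit_vectors"
  shows "f_sigma f (of_real u + v *\<^sub>R \<ss>) \<in> slice \<ss> \<longleftrightarrow>
    f (cnj (Complex u v)) = cnj (f (Complex u v))"
proof -
  have "cnj (Complex u v) = Complex u (- v)"
    by (simp add: complex_eq_iff)
  then show ?thesis
    unfolding f_sigma_slice [OF assms] cplx_combination_in_slice_iff [OF assms]
    by (auto simp: complex_is_Real_iff complex_eq_iff [of "f _"])
qed

text \<open>Replacing \<open>v\<close> by \<open>- v\<close> swaps the two values of
  \<open>f\<close>, hence fixes the symmetric coefficient \<open>a\<close> and negates the
  antisymmetric \<open>b\<close>. Membership in the slice makes both real, and for real coefficients
  this sign change is \<open>pstar\<close>.\<close>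

lemma f_sigma_pstar:
  assumes "\<ss> \<in> unit_vectors" "f_sigma f (of_real u + v *\<^sub>R \<ss>) \<in> slice \<ss>"
  shows "f_sigma f (pstar (of_real u + v *\<^sub>R \<ss>)) = pstar (f_sigma f (of_real u + v *\<^sub>R \<ss>))"
proof -
  define a where "a = (f (Complex u v) + f (Complex u (- v))) / 2"
  define b where "b = \<i> * (f (Complex u (- v)) - f (Complex u v)) / 2"
  have fs: "f_sigma f (of_real u + v *\<^sub>R \<ss>) = cplx a + cscale b \<ss>"
    by (simp add: f_sigma_slice [OF assms(1)] a_def b_def)
  then obtain p q where pq: "a = of_real p" "b = of_real q"
    using assms cplx_combination_in_slice_iff by (metis Reals_cases)
  have "f_sigma f (of_real u + (- v) *\<^sub>R \<ss>) = cplx a + cscale (- b) \<ss>"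
    unfolding f_sigma_slice [OF assms(1)] a_def b_def
    by (intro kliff_eqI) (simp add: field_simps)
  also have "\<dots> = of_real p + (- q) *\<^sub>R \<ss>"
    by (intro kliff_eqI) (simp add: pq coef_of_real)
  also have "\<dots> = pstar (of_real p + q *\<^sub>R \<ss>)"
    by (simp only: pstar_slice [OF assms(1)])
  also have "of_real p + q *\<^sub>R \<ss> = cplx a + cscale b \<ss>"
    by (intro kliff_eqI) (simp add: pq coef_of_real)
  finally show ?thesis
    by (simp only: fs pstar_slice [OF assms(1)])
qed

theorem corollary2:
  fixes U :: "complex set" and f :: "complex \<Rightarrow> complex"
  assumes "conj_symmetric U"
  shows "f \<in> stem_functions U \<longleftrightarrow>
    (\<forall>\<ss>\<in>(unit_vectors :: 'n::{finite,linorder} kliff set). \<forall>\<kappa>\<in>U_sigma U \<inter> slice \<ss>.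
       f_sigma f \<kappa> \<in> slice \<ss> \<and> f_sigma f (pstar \<kappa>) = pstar (f_sigma f \<kappa>))"
    (is "_ \<longleftrightarrow> ?R")
proof
  assume f: "f \<in> stem_functions U"
  show ?R
  proof (intro ballI)
    fix \<ss> \<kappa> :: "'n kliff"
    assume s: "\<ss> \<in> unit_vectors" and "\<kappa> \<in> U_sigma U \<inter> slice \<ss>"
    then obtain u v where \<kappa>: "\<kappa> = of_real u + v *\<^sub>R \<ss>" and "\<kappa> \<in> U_sigma U"
      by (auto simp: slice_def)
    then have "Complex u v \<in> U"
      using slice_in_U_sigma_iff [OF s assms] by simp
    then have "f_sigma f \<kappa> \<in> slice \<ss>"
      using f by (simp only: \<kappa> f_sigma_in_slice_iff [OF s] stem_functions_def mem_Collect_eq)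
    then show "f_sigma f \<kappa> \<in> slice \<ss> \<and> f_sigma f (pstar \<kappa>) = pstar (f_sigma f \<kappa>)"
      using f_sigma_pstar [OF s] \<kappa> by blast
  qed
next
  assume R: ?R
  \<comment> \<open>A single slice already has a point \<open>u + v \<ss>\<close> over every
    \<open>\<zeta> = u + \<i> v\<close> in \<open>U\<close>, so one unit vector is fixed.\<close>
  obtain \<ss> :: "'n kliff" where s: "\<ss> \<in> unit_vectors"
    using e_in_unit_vectors ..
  have "f (cnj \<zeta>) = cnj (f \<zeta>)" if "\<zeta> \<in> U" for \<zeta>
  proof -
    have "of_real (Re \<zeta>) + Im \<zeta> *\<^sub>R \<ss> \<in> U_sigma U \<inter> slice \<ss>"
      using that slice_in_U_sigma_iff [OF s assms] by (auto simp: slice_def)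
    then have "f_sigma f (of_real (Re \<zeta>) + Im \<zeta> *\<^sub>R \<ss>) \<in> slice \<ss>"
      using R s by blast
    then show ?thesis
      by (simp only: f_sigma_in_slice_iff [OF s] complex_surj)
  qed
  then show "f \<in> stem_functions U"
    by (simp add: stem_functions_def)
qed

end
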